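(* Every nilpotent cancellative residuated lattice is Hamiltonian.
   Context: A residuated lattice is an algebra $\mathbf{L}=\langle L,\wedge,\vee,\cdot,\backslash,/,\mathrm{e}\rangle$ such that $\langle L,\cdot,\mathrm{e}\rangle$ is a monoid, $\langle L,\wedge,\vee\rangle$ is a lattice, and for all $a,b,d\in L$: $ab\le d \iff a\le d/b \iff b\le a\backslash d$. It is cancellative if its monoid reduct is a cancellative monoid. Define monoid terms $q_c(x,y,\bar z)$ for $c\ge 1$, with $\bar z=z_1,z_2,\dots$, by $q_1(x,y,\bar z)=xy$ and $q_{c+1}(x,y,\bar z)=q_c(x,y,\bar z)\,z_c\,q_c(y,x,\bar z)$. A residuated lattice is $c$-nilpotent if its monoid reduct satisfies the equation $q_c(x,y,\bar z)\approx q_c(y,x,\bar z)$, and nilpotent if it is $c$-nilpotent for some integer $c\ge 1$. For $a,b\in L$ put $\lambda_b(a)=(b\backslash ab)\wedge \mathrm{e}$ and $\rho_b(a)=(ba/b)\wedge \mathrm{e}$. A convex subuniverse of $\mathbf{L}$ is a subuniverse (subset closed under all operations) that is order-convex; a convex subuniverse $H$ is normal if $\lambda_b(a)\in H$ and $\rho_b(a)\in H$ for all $a\in H$, $b\in L$. $\mathbf{L}$ is Hamiltonian if every convex subuniverse of $\mathbf{L}$ is normal. *)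

theory Defs
  imports Main
begin

class residuated_lattice = lattice + monoid_mult +
  fixes lres :: "'a \<Rightarrow> 'a \<Rightarrow> 'a"  (infix "\<setminus>" 65)
    and rres :: "'a \<Rightarrow> 'a \<Rightarrow> 'a"  (infix "\<sslash>" 65)
  assumes rres_residual: "a * b \<le> d \<longleftrightarrow> a \<le> d \<sslash> b"
    and lres_residual: "a * b \<le> d \<longleftrightarrow> b \<le> a \<setminus> d"

text \<open>
  Properties of the whole algebra are predicates on its type, passed as \<open>TYPE('a)\<close>.
\<close>

definition cancellative :: "'a::monoid_mult itself \<Rightarrow> bool" where
  "cancellative T \<longleftrightarrow>
     (\<forall>a b c::'a. (a * b = a * c \<longrightarrow> b = c) \<and> (b * a = c * a \<longrightarrow> b = c))"

text \<open>
  The tuple of variables \<open>z\<^sub>1, z\<^sub>2, \<dots>\<close> is a function on \<^typ>\<open>nat\<close> whose value at \<open>0\<close> is never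
  used. The terms are meant for index at least \<open>1\<close>; the equation for \<open>0\<close> only makes the
  function total.
\<close>

fun q_term :: "nat \<Rightarrow> 'a::monoid_mult \<Rightarrow> 'a \<Rightarrow> (nat \<Rightarrow> 'a) \<Rightarrow> 'a" where
  "q_term 0 x y z = 1"
| "q_term (Suc 0) x y z = x * y"
| "q_term (Suc (Suc n)) x y z = q_term (Suc n) x y z * z (Suc n) * q_term (Suc n) y x z"

definition c_nilpotent :: "nat \<Rightarrow> 'a::monoid_mult itself \<Rightarrow> bool" where
  "c_nilpotent c T \<longleftrightarrow> (\<forall>(x::'a) y z. q_term c x y z = q_term c y x z)"

definition nilpotent :: "'a::monoid_mult itself \<Rightarrow> bool" where
  "nilpotent T \<longleftrightarrow> (\<exists>c\<ge>1. c_nilpotent c T)"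

definition left_conj :: "'a::residuated_lattice \<Rightarrow> 'a \<Rightarrow> 'a" where
  "left_conj b a = inf (b \<setminus> (a * b)) 1"

definition right_conj :: "'a::residuated_lattice \<Rightarrow> 'a \<Rightarrow> 'a" where
  "right_conj b a = inf ((b * a) \<sslash> b) 1"

definition subuniverse :: "'a::residuated_lattice set \<Rightarrow> bool" where
  "subuniverse H \<longleftrightarrow> 1 \<in> H \<and>
     (\<forall>a\<in>H. \<forall>b\<in>H. inf a b \<in> H \<and> sup a b \<in> H \<and> a * b \<in> H \<and> a \<setminus> b \<in> H \<and> a \<sslash> b \<in> H)"

definition order_convex :: "'a::order set \<Rightarrow> bool" where
  "order_convex H \<longleftrightarrow> (\<forall>a\<in>H. \<forall>b\<in>H. \<forall>x. a \<le> x \<and> x \<le> b \<longrightarrow> x \<in> H)"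

definition convex_subuniverse :: "'a::residuated_lattice set \<Rightarrow> bool" where
  "convex_subuniverse H \<longleftrightarrow> subuniverse H \<and> order_convex H"

definition normal_subuniverse :: "'a::residuated_lattice set \<Rightarrow> bool" where
  "normal_subuniverse H \<longleftrightarrow> convex_subuniverse H \<and>
     (\<forall>a\<in>H. \<forall>b. left_conj b a \<in> H \<and> right_conj b a \<in> H)"

definition hamiltonian :: "'a::residuated_lattice itself \<Rightarrow> bool" where
  "hamiltonian T \<longleftrightarrow> (\<forall>H::'a set. convex_subuniverse H \<longrightarrow> normal_subuniverse H)"

end

theory Submission
  imports Defs
begin

text \<open>
  A cancellative residuated lattice is an ordered monoid in which multiplication also
  reflects the order. The nilpotency law makes any two elements have a common right multiple,
  because its two sides start with different variables. Hence the monoid \<open>M\<close> embeds in a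
  group \<open>G\<close> of fractions \<open>a b\<^sup>-\<^sup>1\<close>; the order extends to \<open>G\<close>, and joins of \<open>M\<close> give joins in \<open>G\<close>,
  so \<open>G\<close> is a lattice-ordered group (written additively below, although it is not
  commutative). The law also passes to \<open>G\<close> in the form of nilpotency: if
  \<open>u w v = v w u\<close> for all \<open>w\<close> in \<open>M\<close>, then \<open>v\<^sup>-\<^sup>1 u\<close> is central in \<open>G\<close>, so a law of index \<open>c + 1\<close>
  becomes one of index \<open>c\<close> modulo the centre (lemma \<open>q_law_mod_Suc\<close>).

  It is therefore enough that in a nilpotent lattice-ordered group every conjugate of a
  positive \<open>x\<close> lies below a multiple of \<open>x\<close> (lemma \<open>conj_by_dominated\<close>). Applied to the inverse
  of some \<open>a \<le> 1\<close> in \<open>M\<close>, this says \<open>b a\<^sup>n \<le> a b\<close> and \<open>a\<^sup>m b \<le> b a\<close> for some \<open>n\<close> and \<open>m\<close>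
  (lemma \<open>power_le_conjugate\<close>), so the two conjugates of an element of a convex subuniverse
  are squeezed between a power of an element of it and the identity.

  For the statement on lattice-ordered groups only the Engel condition is used: iterated
  commutation with a fixed \<open>h\<close> leads to \<open>0\<close> after \<open>c\<close> steps. Write \<open>x\<^sub>i\<close> for the conjugate of
  \<open>x\<close> by the \<open>i\<close>-th multiple of \<open>h\<close>. The condition has three consequences.

  \<^item> Each \<open>x\<^sub>i\<close> lies in the subgroup generated by any \<open>c\<close> consecutive ones. Hence, if
    \<open>z = x\<^sub>0 \<sqinter> \<dots> \<sqinter> x\<^sub>c\<close>, then for each of \<open>x\<^sub>0, \<dots>, x\<^sub>c\<close> there are \<open>c\<close> consecutive
    conjugates of \<open>z\<close> below it, and so all conjugates of \<open>z\<close> are below multiples of it: the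
    convex subgroup generated by \<open>z\<close> is invariant under conjugation by \<open>h\<close> (lemma \<open>conj_meet_pow_invariant\<close>).

  \<^item> As lattice-ordered groups are torsion free, an element that commutes with a positive
    multiple of \<open>h\<close> commutes with \<open>h\<close> (lemma \<open>commutes_with_root\<close>).

  \<^item> If \<open>y\<close> is disjoint from its conjugate by \<open>h\<close>, then \<open>y = 0\<close> (lemma
    \<open>disjoint_conjugates_eq_0\<close>), which follows from the first two by a downward induction on
    the number of conjugates from which \<open>y\<close> is assumed to be disjoint.

  Finally let \<open>w\<^sub>m = x\<^sub>0 \<sqinter> \<dots> \<sqinter> x\<^sub>m\<close>. Subtracting from \<open>w\<^sub>m\<close> its overlap with its neighbours leaves
  an element disjoint from its conjugate, hence \<open>0\<close>; so \<open>w\<^sub>m\<close> equals that overlap, which is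
  the join of \<open>w\<^sub>m\<^sub>+\<^sub>1\<close> and its conjugate by \<open>- h\<close>. Descending from \<open>w\<^sub>c\<close>, whose convex
  subgroup is invariant, one finds that \<open>x\<^sub>0\<close> generates the same convex subgroup as \<open>w\<^sub>c\<close>.
\<close>

section \<open>Conjugation, commutators and the Engel condition\<close>

text \<open>
  Used with \<open>simp only\<close>, these equations reduce words in a non-commutative group to right-nested
  freely reduced sums, which decides equations between such words. They keep \<open>x + - y\<close> as it is,
  whereas the default simplification rules turn it into a difference.
\<close>

lemmas group_norm = minus_add add.assoc minus_minus minus_add_cancel add_minus_cancel
  left_minus right_minus add_0_left add_0_right minus_zero

definition conj_by :: "'g::group_add \<Rightarrow> 'g \<Rightarrow> 'g" where
  "conj_by h x = - h + x + h"

lemma conj_by_add: "conj_by h (x + y) = conj_by h x + conj_by h y"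
  by (simp only: conj_by_def group_norm)

lemma conj_by_uminus: "conj_by h (- x) = - conj_by h x"
  by (simp only: conj_by_def group_norm)

lemma conj_by_zero: "conj_by h 0 = 0"
  by (simp only: conj_by_def group_norm)

lemma conj_by_conj_by: "conj_by k (conj_by h x) = conj_by (h + k) x"
  by (simp only: conj_by_def group_norm)

lemma conj_by_by_zero: "conj_by 0 x = x"
  by (simp only: conj_by_def group_norm)

lemma conj_by_cancel: "conj_by (- h) (conj_by h x) = x" "conj_by h (conj_by (- h) x) = x"
  by (simp_all only: conj_by_def group_norm)

lemmas conj_simps = conj_by_add conj_by_uminus conj_by_zero

definition commutator :: "'g::group_add \<Rightarrow> 'g \<Rightarrow> 'g" where
  "commutator h x = - x + conj_by h x"

lemma commutator_eq_0_iff: "commutator h x = 0 \<longleftrightarrow> conj_by h x = x"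
  unfolding commutator_def
  by (metis add.right_inverse add_minus_cancel add_0_right left_minus minus_add_cancel)

primrec multiple :: "nat \<Rightarrow> 'g::monoid_add \<Rightarrow> 'g" where
  "multiple 0 x = 0"
| "multiple (Suc n) x = x + multiple n x"

lemma multiple_add: "multiple (m + n) x = multiple m x + multiple n x"
  by (induction m) (simp_all add: add.assoc)

lemma multiple_mult: "multiple (m * n) x = multiple m (multiple n x)"
  by (induction m) (simp_all add: multiple_add)

lemma multiple_Suc_right: "multiple (Suc n) x = multiple n x + x"
  using multiple_add[of n 1 x] by simp

lemma multiple_uminus: "multiple n (- x) = - multiple n (x::'g::group_add)"
proof (induction n)
  case (Suc n)
  have "multiple (Suc n) (- x) = - multiple n x + - x"
    by (simp only: multiple_Suc_right Suc)
  then show ?case by (simp add: minus_add)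
qed simp

lemma conj_by_multiple: "conj_by h (multiple n x) = multiple n (conj_by h x)"
  by (induction n) (simp_all add: conj_simps)

lemma conj_by_by_multiple: "conj_by (multiple n h) x = (conj_by h ^^ n) x"
  by (induction n)
    (simp_all add: conj_by_by_zero multiple_Suc_right conj_by_conj_by[symmetric] del: multiple.simps(2))

lemma conj_pow_add: "(conj_by h ^^ n) (x + y) = (conj_by h ^^ n) x + (conj_by h ^^ n) y"
  by (induction n) (simp_all add: conj_simps)

lemma conj_pow_uminus: "(conj_by h ^^ n) (- x) = - (conj_by h ^^ n) x"
  by (induction n) (simp_all add: conj_simps)

lemma commutator_conj_pow: "(conj_by h ^^ n) (commutator h x) = commutator h ((conj_by h ^^ n) x)"
  by (simp add: commutator_def conj_pow_add conj_pow_uminus funpow_swap1)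

definition engel :: "nat \<Rightarrow> 'g::group_add itself \<Rightarrow> bool" where
  "engel c T \<longleftrightarrow> (\<forall>h x::'g. (commutator h ^^ c) x = 0)"

lemma engel_mono:
  fixes T :: "'g::group_add itself"
  assumes "engel c T" "c \<le> d"
  shows "engel d T"
proof -
  have "(commutator h ^^ (c + (d - c))) x = 0" for h x :: 'g
    unfolding funpow_add o_apply using assms(1) by (simp add: engel_def)
  then show ?thesis using assms(2) by (simp add: engel_def)
qed

definition add_subgroup :: "'g::group_add set \<Rightarrow> bool" where
  "add_subgroup S \<longleftrightarrow> 0 \<in> S \<and> (\<forall>x\<in>S. \<forall>y\<in>S. x + y \<in> S) \<and> (\<forall>x\<in>S. - x \<in> S)"

lemma add_subgroupD:
  assumes "add_subgroup S"
  shows "0 \<in> S" "x \<in> S \<Longrightarrow> y \<in> S \<Longrightarrow> x + y \<in> S" "x \<in> S \<Longrightarrow> - x \<in> S"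
  using assms by (auto simp: add_subgroup_def)

lemma add_subgroup_uminus_iff:
  assumes "add_subgroup S"
  shows "- x \<in> S \<longleftrightarrow> x \<in> S"
  using add_subgroupD(3)[OF assms] by (metis minus_minus)

lemma add_subgroup_cancel_left:
  assumes "add_subgroup S" "x \<in> S"
  shows "x + y \<in> S \<longleftrightarrow> y \<in> S"
  using add_subgroupD[OF assms(1)] assms(2) by (metis minus_add_cancel)

lemma add_subgroup_cancel_right:
  assumes "add_subgroup S" "y \<in> S"
  shows "x + y \<in> S \<longleftrightarrow> x \<in> S"
  using add_subgroupD[OF assms(1)] assms(2) by (metis add.right_inverse add_0_right add.assoc)

text \<open>
  The \<open>k\<close>-fold commutator of \<open>x\<close> with \<open>h\<close> is a word in the conjugates \<open>x\<^sub>0, \<dots>, x\<^sub>k\<close> in which \<open>x\<^sub>k\<close>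
  occurs exactly once, and so does \<open>x\<^sub>0\<close>. Replacing \<open>x\<close> by its commutator lowers \<open>k\<close> by one. The next lemma solves the same word for \<open>x\<^sub>0\<close>.
\<close>

lemma engel_next_in_subgroup:
  assumes S: "add_subgroup S" and "(commutator h ^^ k) x \<in> S"
    "\<And>i. i < k \<Longrightarrow> (conj_by h ^^ i) x \<in> S"
  shows "(conj_by h ^^ k) x \<in> S"
  using assms(2,3)
proof (induction k arbitrary: x)
  case (Suc k)
  have "(conj_by h ^^ i) (commutator h x) \<in> S" if "i < k" for i
    using Suc.prems(2)[of i] Suc.prems(2)[of "Suc i"] that add_subgroupD[OF S]
    by (simp add: commutator_def conj_pow_add conj_pow_uminus funpow_swap1)
  then have "(conj_by h ^^ k) (commutator h x) \<in> S"
    using Suc by (simp add: funpow_swap1)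
  then have "- (conj_by h ^^ k) x + (conj_by h ^^ Suc k) x \<in> S"
    by (simp add: commutator_def conj_pow_add conj_pow_uminus funpow_swap1)
  then show ?case
    using Suc.prems(2)[of k] add_subgroup_cancel_left[OF S] add_subgroupD(3)[OF S] by blast
qed simp

lemma engel_previous_in_subgroup:
  assumes S: "add_subgroup S" and "(commutator h ^^ k) x \<in> S"
    "\<And>i. 1 \<le> i \<Longrightarrow> i \<le> k \<Longrightarrow> (conj_by h ^^ i) x \<in> S"
  shows "x \<in> S"
  using assms(2,3)
proof (induction k arbitrary: x)
  case (Suc k)
  have "(conj_by h ^^ i) (commutator h x) \<in> S" if "1 \<le> i" "i \<le> k" for i
    using Suc.prems(2)[of i] Suc.prems(2)[of "Suc i"] that add_subgroupD[OF S]
    by (simp add: commutator_def conj_pow_add conj_pow_uminus funpow_swap1)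
  then have "commutator h x \<in> S"
    using Suc by (simp add: funpow_swap1)
  then show ?case
    using Suc.prems(2)[of 1] add_subgroup_cancel_right[OF S] add_subgroup_uminus_iff[OF S]
    by (auto simp: commutator_def)
qed simp

text \<open>
  The window of \<open>c\<close> consecutive conjugates is pushed upwards by solving for the last letter of
  the \<open>c\<close>-fold commutator, and downwards by solving for the first one.
\<close>

lemma engel_orbit_in_subgroup:
  fixes x :: "'g::group_add"
  assumes "engel c TYPE('g)" and S: "add_subgroup S"
    and window: "\<And>i. m \<le> i \<Longrightarrow> i < m + c \<Longrightarrow> (conj_by h ^^ i) x \<in> S"
  shows "(conj_by h ^^ k) x \<in> S"
proof -
  have E: "(commutator h ^^ c) y \<in> S" for y
    using assms(1) add_subgroupD(1)[OF S] by (simp add: engel_def)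
  have "\<forall>i. n \<le> i \<and> i < n + c \<longrightarrow> (conj_by h ^^ i) x \<in> S" for n
  proof (cases "m \<le> n")
    case True
    then show ?thesis
    proof (induction n rule: dec_induct)
      case base
      then show ?case using window by simp
    next
      case (step n)
      have "(conj_by h ^^ c) ((conj_by h ^^ n) x) \<in> S"
        by (rule engel_next_in_subgroup[OF S E])
          (use step in \<open>simp add: funpow_add[symmetric, THEN fun_cong, simplified]\<close>)
      then have "(conj_by h ^^ (n + c)) x \<in> S"
        by (simp add: add.commute[of n] funpow_add)
      with step show ?case
        by (metis Suc_leD add_Suc less_SucE)
    qed
  next
    case False
    then have "n \<le> m" by simp
    then show ?thesis
    proof (induction n rule: inc_induct)
      case base
      then show ?case using window by simp
    next
      case (step n)
      have "(conj_by h ^^ n) x \<in> S"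
        by (rule engel_previous_in_subgroup[OF S E])
          (use step in \<open>simp add: funpow_add[symmetric, THEN fun_cong, simplified]\<close>)
      with step show ?case
        by (metis Suc_leI add_Suc le_neq_implies_less less_SucI)
    qed
  qed
  then have *: "c > 0 \<Longrightarrow> ?thesis" by (metis less_add_same_cancel1 order_refl)
  show ?thesis
  proof (cases "c = 0")
    case True
    then show ?thesis using E[of "(conj_by h ^^ k) x"] by simp
  qed (use * in simp)
qed

text \<open>
  If the commutator \<open>- x + x\<^sub>1\<close> is fixed by \<open>h\<close>, it equals each \<open>- x\<^sub>i + x\<^sub>i\<^sub>+\<^sub>1\<close>, and the sum of these
  telescopes without any commutativity.
\<close>

lemma multiple_commutator_telescope:
  assumes "conj_by h (commutator h x) = commutator h x"
  shows "multiple n (commutator h x) = - x + (conj_by h ^^ n) x"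
proof (induction n)
  case (Suc n)
  have fixed: "(conj_by h ^^ n) (commutator h x) = commutator h x" for n
    by (induction n) (simp_all add: assms)
  have "multiple (Suc n) (commutator h x) = - x + (conj_by h ^^ n) x + (conj_by h ^^ n) (commutator h x)"
    by (simp add: multiple_Suc_right Suc fixed del: multiple.simps(2))
  also have "\<dots> = - x + (conj_by h ^^ Suc n) x"
    by (simp add: commutator_def conj_pow_add conj_pow_uminus funpow_swap1 add.assoc)
  finally show ?case .
qed simp

section \<open>Lattice-ordered groups\<close>

class lattice_group = group_add + lattice +
  assumes add_left_isotone: "a \<le> b \<Longrightarrow> c + a \<le> c + b"
    and add_right_isotone: "a \<le> b \<Longrightarrow> a + c \<le> b + c"

lemma lattice_group_add_mono:
  fixes a :: "'g::lattice_group"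
  assumes "a \<le> b" "c \<le> d"
  shows "a + c \<le> b + d"
  using add_left_isotone[OF assms(2)] add_right_isotone[OF assms(1)] order_trans by blast

lemma lattice_group_add_le_cancel_left: "c + a \<le> c + b \<longleftrightarrow> a \<le> (b::'g::lattice_group)"
  using add_left_isotone[of a b c] add_left_isotone[of "c + a" "c + b" "- c"]
  by (auto simp: add.assoc[symmetric])

lemma lattice_group_add_le_cancel_right: "a + c \<le> b + c \<longleftrightarrow> a \<le> (b::'g::lattice_group)"
  using add_right_isotone[of a b c] add_right_isotone[of "a + c" "b + c" "- c"]
  by (auto simp only: group_norm)

lemma lattice_group_uminus_le_iff: "- a \<le> - b \<longleftrightarrow> b \<le> (a::'g::lattice_group)"
  using lattice_group_add_le_cancel_left[of a "- a" "- b"]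
    lattice_group_add_le_cancel_right[of b b a] lattice_group_add_le_cancel_right[of 0 b "a + - b"]
  by (simp only: group_norm)

lemma lattice_group_add_inf_distrib_left: "c + inf a b = inf (c + a) (c + (b::'g::lattice_group))"
proof (rule antisym)
  have "- c + inf (c + a) (c + b) \<le> a" "- c + inf (c + a) (c + b) \<le> b"
    using add_left_isotone[OF inf.cobounded1, of "- c" "c + a" "c + b"]
      add_left_isotone[OF inf.cobounded2, of "- c" "c + a" "c + b"] by (simp_all only: group_norm)
  then have "- c + inf (c + a) (c + b) \<le> inf a b" by simp
  then show "inf (c + a) (c + b) \<le> c + inf a b"
    using lattice_group_add_le_cancel_left[of "- c" "inf (c + a) (c + b)" "c + inf a b"]
    by (simp add: add.assoc[symmetric])
qed (simp add: add_left_isotone)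

lemma lattice_group_add_inf_distrib_right: "inf a b + c = inf (a + c) (b + (c::'g::lattice_group))"
proof (rule antisym)
  have "inf (a + c) (b + c) + - c \<le> a" "inf (a + c) (b + c) + - c \<le> b"
    using add_right_isotone[OF inf.cobounded1, of "a + c" "b + c" "- c"]
     add_right_isotone[OF inf.cobounded2, of "a + c" "b + c" "- c"] by (simp_all only: group_norm)
  then have "inf (a + c) (b + c) + - c + c \<le> inf a b + c"
    by (intro add_right_isotone) simp
  then show "inf (a + c) (b + c) \<le> inf a b + c"
    by (simp only: group_norm)
qed (simp add: add_right_isotone)

text \<open>
  Expanding the right-hand side by distributivity gives the meet of \<open>a + a\<close>, \<open>b + a\<close>, \<open>a + c\<close> and
  \<open>b + c\<close>, of which the first three are above \<open>a\<close>.
\<close>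

lemma inf_add_le:
  fixes a b c :: "'g::lattice_group"
  assumes "0 \<le> a" "0 \<le> b" "0 \<le> c"
  shows "inf a (b + c) \<le> inf a b + inf a c"
proof -
  have "inf a b + inf a c = inf (inf (a + a) (b + a)) (inf (a + c) (b + c))"
    by (simp add: lattice_group_add_inf_distrib_left lattice_group_add_inf_distrib_right)
  moreover have "a \<le> a + a" "a \<le> b + a" "a \<le> a + c"
    using lattice_group_add_mono[of a a 0 a] lattice_group_add_mono[of 0 b a a]
      lattice_group_add_mono[of a a 0 c] assms
    by simp_all
  ultimately show ?thesis by (simp add: inf.coboundedI1)
qed

lemma conj_by_mono: "x \<le> y \<Longrightarrow> conj_by h x \<le> conj_by h (y::'g::lattice_group)"
  unfolding conj_by_def by (intro add_right_isotone add_left_isotone)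

lemma conj_by_inf: "conj_by h (inf x y) = inf (conj_by h x) (conj_by h (y::'g::lattice_group))"
  unfolding conj_by_def by (simp add: lattice_group_add_inf_distrib_left lattice_group_add_inf_distrib_right)

lemma conj_by_nonneg: "0 \<le> x \<Longrightarrow> 0 \<le> conj_by h (x::'g::lattice_group)"
  using conj_by_mono[of 0 x h] by (simp add: conj_by_zero)

lemma conj_pow_mono: "x \<le> y \<Longrightarrow> (conj_by h ^^ n) x \<le> (conj_by h ^^ n) (y::'g::lattice_group)"
  by (induction n) (simp_all add: conj_by_mono)

lemma conj_pow_nonneg: "0 \<le> x \<Longrightarrow> 0 \<le> (conj_by h ^^ n) (x::'g::lattice_group)"
  by (induction n) (simp_all add: conj_by_nonneg)

lemma conj_pow_inf:
  "(conj_by h ^^ n) (inf x y) = inf ((conj_by h ^^ n) x) ((conj_by h ^^ n) (y::'g::lattice_group))"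
  by (induction n) (simp_all add: conj_by_inf)

lemma conj_pow_zero: "(conj_by h ^^ n) 0 = 0"
  by (induction n) (simp_all add: conj_by_zero)

lemma multiple_mono: "x \<le> y \<Longrightarrow> multiple n x \<le> multiple n (y::'g::lattice_group)"
  by (induction n) (simp_all add: lattice_group_add_mono)

lemma multiple_nonneg: "0 \<le> x \<Longrightarrow> 0 \<le> multiple n (x::'g::lattice_group)"
  using lattice_group_add_mono[of 0 x 0] by (induction n) auto

text \<open>
  Let \<open>w m\<close> be the \<open>m\<close>-th multiple of \<open>u \<sqinter> 0\<close>, which is the meet of the multiples of \<open>u\<close> up to the
  \<open>m\<close>-th. If the \<open>n\<close>-th multiple of \<open>u\<close> is \<open>0\<close>, the meets for \<open>n - 1\<close> and \<open>n\<close> coincide, because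
  the one for \<open>n - 1\<close> already contains \<open>0\<close>; hence \<open>u \<sqinter> 0 = 0\<close>.
\<close>

lemma multiple_eq_0_imp_nonneg:
  fixes u :: "'g::lattice_group"
  assumes "multiple n u = 0" "n > 0"
  shows "0 \<le> u"
proof -
  obtain k where n: "n = Suc k" using assms(2) by (cases n) auto
  define w where "w m = multiple m (inf u 0)" for m
  have w_Suc: "w (Suc m) = inf (multiple (Suc m) u) (w m)" for m
  proof (induction m)
    case (Suc m)
    have "w (Suc (Suc m)) = inf u 0 + w (Suc m)" by (simp add: w_def)
    also have "\<dots> = inf u 0 + inf (multiple (Suc m) u) (w m)" using Suc by simp
    also have "\<dots> = inf (inf (multiple (Suc (Suc m)) u) (multiple (Suc m) u)) (inf u 0 + w m)"
      by (simp add: lattice_group_add_inf_distrib_left lattice_group_add_inf_distrib_right inf.assoc)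
    also have "inf u 0 + w m = w (Suc m)" by (simp add: w_def)
    finally have "w (Suc (Suc m)) = inf (multiple (Suc (Suc m)) u) (inf (multiple (Suc m) u) (w (Suc m)))"
      by (simp only: inf.assoc)
    also have "inf (multiple (Suc m) u) (w (Suc m)) = w (Suc m)" using Suc by (metis inf.left_idem)
    finally show ?case .
  qed (simp add: w_def)
  have "inf u 0 \<le> 0" by simp
  then have "w m \<le> 0" for m
    using multiple_mono[of "inf u 0" 0 m] multiple_mult[of m 0 u] by (simp add: w_def)
  then have "inf u 0 + w k = w k"
    using w_Suc[of k] assms(1) n by (simp add: w_def inf.absorb2)
  then have "inf u 0 = 0" by (metis add_0_left add_right_cancel)
  then show ?thesis by (simp add: inf.absorb_iff2)
qed

lemma torsion_free:
  fixes u :: "'g::lattice_group"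
  assumes "multiple n u = 0" "n > 0"
  shows "u = 0"
proof (rule antisym)
  have "multiple n (- u) = 0" using assms by (simp add: multiple_uminus)
  then show "u \<le> 0" using multiple_eq_0_imp_nonneg[of n "- u"] assms lattice_group_uminus_le_iff[of 0 u]
    by simp
qed (rule multiple_eq_0_imp_nonneg[OF assms])

text \<open>
  Every iterated commutator \<open>e\<^sub>k\<close> of \<open>x\<close> with \<open>h\<close> is fixed by the \<open>d\<close>-th power of the conjugation.
  If \<open>e\<^sub>k\<^sub>+\<^sub>2 = 0\<close>, then \<open>e\<^sub>k\<^sub>+\<^sub>1\<close> is fixed by \<open>h\<close>, so its \<open>d\<close>-th multiple telescopes to the commutator
  of \<open>e\<^sub>k\<close> with the \<open>d\<close>-th multiple of \<open>h\<close>, which is \<open>0\<close>; as there is no torsion, \<open>e\<^sub>k\<^sub>+\<^sub>1 = 0\<close>.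
  Descending from \<open>e\<^sub>c = 0\<close> gives \<open>e\<^sub>1 = 0\<close>.
\<close>

lemma commutes_with_root:
  fixes x :: "'g::lattice_group"
  assumes E: "engel c TYPE('g)" and "d > 0" "(conj_by h ^^ d) x = x"
  shows "conj_by h x = x"
proof -
  have comm_pow: "(conj_by h ^^ d) ((commutator h ^^ n) x) = (commutator h ^^ n) x" for n
    by (induction n) (simp_all add: assms commutator_conj_pow)
  have step: "(commutator h ^^ Suc k) x = 0" if "(commutator h ^^ Suc (Suc k)) x = 0" for k
  proof -
    define y where "y = (commutator h ^^ k) x"
    have "conj_by h (commutator h y) = commutator h y"
      using that by (simp add: y_def commutator_eq_0_iff)
    then have "multiple d (commutator h y) = 0"
      using comm_pow[of k] by (simp add: multiple_commutator_telescope y_def)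
    then show ?thesis using torsion_free \<open>d > 0\<close> by (auto simp: y_def)
  qed
  have "(commutator h ^^ Suc k) x = 0" for k
  proof (cases "k \<le> c")
    case True
    then show ?thesis
    proof (induction k rule: inc_induct)
      case base
      then show ?case using E by (simp add: engel_def commutator_eq_0_iff conj_by_zero)
    qed (use step in blast)
  next
    case False
    then have "(commutator h ^^ (c + (Suc k - c))) x = 0"
      using E unfolding engel_def funpow_add by simp
    then show ?thesis using False by simp
  qed
  from this[of 0] show ?thesis by (simp add: commutator_eq_0_iff)
qed

section \<open>Domination between positive elements\<close>

text \<open>
  For positive \<open>x\<close> and \<open>y\<close> this says that \<open>x\<close> belongs to the convex subgroup generated by \<open>y\<close>.
  It replaces the lattice of principal convex subgroups in what follows.
\<close>

definition dominated :: "'g::lattice_group \<Rightarrow> 'g \<Rightarrow> bool" where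
  "dominated x y \<longleftrightarrow> (\<exists>n. x \<le> multiple n y)"

lemma le_imp_dominated: "x \<le> y \<Longrightarrow> dominated x y"
  unfolding dominated_def by (rule exI[of _ 1]) simp

lemma dominated_trans:
  assumes "dominated x y" "dominated y z"
  shows "dominated x z"
proof -
  obtain m n where "x \<le> multiple m y" "y \<le> multiple n z"
    using assms by (auto simp: dominated_def)
  then have "x \<le> multiple (m * n) z"
    using multiple_mono[of y "multiple n z" m] by (simp add: multiple_mult)
  then show ?thesis by (auto simp: dominated_def)
qed

lemma dominated_add: "dominated x z \<Longrightarrow> dominated y z \<Longrightarrow> dominated (x + y) z"
  unfolding dominated_def by (metis lattice_group_add_mono multiple_add)

lemma dominated_zero: "dominated 0 z"
  unfolding dominated_def by (rule exI[of _ 0]) simp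

lemma dominated_conj_by: "dominated x y \<Longrightarrow> dominated (conj_by h x) (conj_by h y)"
  unfolding dominated_def using conj_by_mono conj_by_multiple by metis

lemma dominated_conj_by_iff: "dominated (conj_by h x) (conj_by h y) \<longleftrightarrow> dominated x y"
  using dominated_conj_by[of "conj_by h x" "conj_by h y" "- h"] dominated_conj_by
  by (auto simp: conj_by_cancel)

lemma dominated_conj_pow_iff:
  "dominated ((conj_by h ^^ n) x) ((conj_by h ^^ n) y) \<longleftrightarrow> dominated x y"
  by (induction n) (simp_all add: dominated_conj_by_iff)

lemma inf_multiple_le:
  fixes a b :: "'g::lattice_group"
  assumes "0 \<le> a" "0 \<le> b"
  shows "inf a (multiple n b) \<le> multiple n (inf a b)"
proof (induction n)
  case (Suc n)
  have "inf a (multiple (Suc n) b) \<le> inf a b + inf a (multiple n b)"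
    using inf_add_le[OF assms(1) assms(2) multiple_nonneg[OF assms(2)]] by simp
  also have "\<dots> \<le> inf a b + multiple n (inf a b)"
    using Suc by (rule add_left_isotone)
  finally show ?case by simp
qed simp

text \<open>
  The intersection of the convex subgroups generated by \<open>x\<close> and \<open>y\<close> is generated by \<open>x \<sqinter> y\<close>. Since
  \<open>n (x \<sqinter> y)\<close> need not be \<open>n x \<sqinter> n y\<close>, one passes through \<open>z \<sqinter> x\<close>: it dominates \<open>z\<close> and is itself
  below \<open>x \<sqinter> n y\<close>.
\<close>

lemma dominated_inf:
  fixes x y z :: "'g::lattice_group"
  assumes "0 \<le> x" "0 \<le> y" "0 \<le> z" "dominated z x" "dominated z y"
  shows "dominated z (inf x y)"
proof -
  obtain m n where mn: "z \<le> multiple m x" "z \<le> multiple n y"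
    using assms by (auto simp: dominated_def)
  have "dominated z (inf z x)"
    using inf_multiple_le[of z x m] assms mn(1) by (auto simp: dominated_def inf.absorb1)
  moreover have "inf z x \<le> inf x (multiple n y)"
    using mn(2) by (simp add: le_infI1)
  then have "inf z x \<le> multiple n (inf x y)"
    using inf_multiple_le[of x y n] assms by (meson order_trans)
  then have "dominated (inf z x) (inf x y)" by (auto simp: dominated_def)
  ultimately show ?thesis by (rule dominated_trans)
qed

lemma dominated_sup:
  fixes x y z :: "'g::lattice_group"
  assumes "0 \<le> x" "0 \<le> y" "dominated x z" "dominated y z"
  shows "dominated (sup x y) z"
proof -
  have "sup x y \<le> x + y"
    using add_left_isotone[of 0 y x] add_right_isotone[of 0 x y] assms by simp
  then show ?thesis
    using assms dominated_add dominated_trans le_imp_dominated by blast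
qed

lemma disjoint_dominated:
  fixes a x y :: "'g::lattice_group"
  assumes "inf a y = 0" "0 \<le> x" "dominated x y"
  shows "inf a x = 0"
proof -
  have nonneg: "0 \<le> a" "0 \<le> y" using assms(1) by (metis inf.cobounded1, metis inf.cobounded2)
  obtain n where n: "x \<le> multiple n y" using assms(3) by (auto simp: dominated_def)
  have "inf a x \<le> inf a (multiple n y)" using n by (simp add: le_infI2)
  also have "\<dots> \<le> multiple n 0" using inf_multiple_le[OF nonneg] assms(1) by simp
  also have "multiple n (0::'g) = 0" by (induction n) simp_all
  finally show ?thesis using assms(2) nonneg by (intro antisym) simp_all
qed

text \<open>
  For positive \<open>w\<close> this is the convex subgroup generated by \<open>w\<close>.
\<close>

definition bounded_by :: "'g::lattice_group \<Rightarrow> 'g set" where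
  "bounded_by w = {x. dominated x w \<and> dominated (- x) w}"

lemma add_subgroup_bounded_by: "add_subgroup (bounded_by w)"
  by (auto simp: add_subgroup_def bounded_by_def dominated_zero dominated_add minus_add
      simp del: add_uminus_conv_diff)

lemma nonneg_in_bounded_by:
  assumes "0 \<le> x"
  shows "x \<in> bounded_by w \<longleftrightarrow> dominated x w"
proof -
  have "dominated (- x) w"
    using assms lattice_group_uminus_le_iff[of x 0] dominated_zero le_imp_dominated
      dominated_trans by (metis minus_zero)
  then show ?thesis by (simp add: bounded_by_def)
qed

lemma bounded_by_trans: "x \<in> bounded_by y \<Longrightarrow> dominated y z \<Longrightarrow> x \<in> bounded_by z"
  using dominated_trans by (auto simp: bounded_by_def)

lemma conj_by_in_bounded_by: "x \<in> bounded_by y \<Longrightarrow> conj_by h x \<in> bounded_by (conj_by h y)"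
  by (simp add: bounded_by_def dominated_conj_by_iff flip: conj_by_uminus)

lemma bounded_by_disjoint:
  fixes x :: "'g::lattice_group"
  assumes "inf y z = 0" "x \<in> bounded_by y" "x \<in> bounded_by z"
  shows "x = 0"
proof -
  have nonneg: "0 \<le> y" "0 \<le> z" using assms(1) by (metis inf.cobounded1, metis inf.cobounded2)
  have *: "u \<le> 0" if u: "dominated u y" "dominated u z" for u
  proof -
    obtain m n where mn: "u \<le> multiple m y" "u \<le> multiple n z"
      using u by (auto simp: dominated_def)
    have "inf y (multiple n z) = 0"
      using disjoint_dominated[OF assms(1)] multiple_nonneg[OF nonneg(2)] by (auto simp: dominated_def)
    then have "inf (multiple n z) (multiple m y) = 0"
      using disjoint_dominated[of "multiple n z" y "multiple m y"] multiple_nonneg[OF nonneg(1)]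
      by (auto simp: dominated_def inf.commute)
    then show ?thesis using mn by (metis le_inf_iff)
  qed
  have "x \<le> 0" "- x \<le> 0" using * assms by (auto simp: bounded_by_def)
  then show ?thesis using lattice_group_uminus_le_iff[of x 0] by simp
qed

lemma engel_orbit_dominated:
  fixes x :: "'g::lattice_group"
  assumes E: "engel c TYPE('g)" and "0 \<le> x"
    and "\<And>i. m \<le> i \<Longrightarrow> i < m + c \<Longrightarrow> dominated ((conj_by h ^^ i) x) w"
  shows "dominated ((conj_by h ^^ k) x) w"
  using engel_orbit_in_subgroup[OF E add_subgroup_bounded_by, of m h x w] assms
  by (simp add: nonneg_in_bounded_by conj_pow_nonneg)

section \<open>Conjugates in lattice-ordered Engel groups\<close>

text \<open>
  The \<open>m\<close>-th iterate at \<open>x\<close> is \<open>x\<^sub>0 \<sqinter> \<dots> \<sqinter> x\<^sub>m\<close>. Defined as an iteration, the passage from \<open>m\<close> to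
  \<open>m + 1\<close> is the overlap of an element with its own conjugate, the form in which
  disjointness enters.
\<close>

definition conj_meet :: "'g::lattice_group \<Rightarrow> 'g \<Rightarrow> 'g" where
  "conj_meet h x = inf x (conj_by h x)"

lemma conj_meet_Suc:
  "(conj_meet h ^^ Suc m) x = inf ((conj_meet h ^^ m) x) (conj_by h ((conj_meet h ^^ m) x))"
  by (simp add: conj_meet_def)

lemma conj_meet_pow_nonneg: "0 \<le> x \<Longrightarrow> 0 \<le> (conj_meet h ^^ m) x"
  by (induction m) (simp_all add: conj_meet_def conj_by_nonneg)

lemma conj_pow_conj_meet_pow:
  "(conj_by h ^^ i) ((conj_meet h ^^ m) x) = (conj_meet h ^^ m) ((conj_by h ^^ i) x)"
proof (induction m)
  case (Suc m)
  have "(conj_by h ^^ i) (conj_by h y) = conj_by h ((conj_by h ^^ i) y)" for y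
    by (simp add: funpow_swap1)
  with Suc show ?case by (simp only: conj_meet_Suc conj_pow_inf)
qed simp

lemma conj_meet_pow_le: "k \<le> m \<Longrightarrow> (conj_meet h ^^ m) x \<le> (conj_by h ^^ k) x"
proof (induction m arbitrary: k)
  case (Suc m)
  show ?case
  proof (cases k)
    case 0
    then show ?thesis unfolding conj_meet_Suc using Suc.IH[of 0] by (simp add: le_infI1)
  next
    case (Suc k')
    then have "conj_by h ((conj_meet h ^^ m) x) \<le> (conj_by h ^^ k) x"
      using Suc.IH[of k'] Suc.prems conj_by_mono by simp
    then show ?thesis unfolding conj_meet_Suc by (rule le_infI2)
  qed
qed simp

lemma dominated_conj_meet_pow:
  assumes "0 \<le> z" "0 \<le> x" "\<And>k. k \<le> m \<Longrightarrow> dominated z ((conj_by h ^^ k) x)"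
  shows "dominated z ((conj_meet h ^^ m) x)"
  using assms(2,3)
proof (induction m arbitrary: x)
  case (Suc m)
  have "dominated z ((conj_meet h ^^ m) x)" using Suc by simp
  moreover have "dominated z ((conj_meet h ^^ m) (conj_by h x))"
    using Suc.prems(2)[of "Suc _"] by (intro Suc.IH) (simp_all add: conj_by_nonneg Suc.prems funpow_swap1)
  moreover have "(conj_meet h ^^ m) (conj_by h x) = conj_by h ((conj_meet h ^^ m) x)"
    using conj_pow_conj_meet_pow[of 1 h m x] by simp
  ultimately show ?case
    unfolding conj_meet_Suc
    using Suc.prems by (intro dominated_inf) (simp_all add: conj_meet_pow_nonneg conj_by_nonneg assms(1))
qed simp

text \<open>
  By construction \<open>z\<^sub>i \<le> x\<^sub>j\<close> whenever \<open>i \<le> j \<le> i + c\<close>. For \<open>c \<le> j \<le> 2 c\<close> this bounds \<open>c\<close> consecutive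
  conjugates of \<open>z\<close> by \<open>x\<^sub>j\<close>, so the Engel condition makes every \<open>z\<^sub>k\<close> dominated by \<open>x\<^sub>j\<close>. Hence
  \<open>z\<^sub>k\<close> is dominated by \<open>x\<^sub>c \<sqinter> \<dots> \<sqinter> x\<^sub>2\<^sub>c = z\<^sub>c\<close>; take \<open>k = c + 1\<close> and \<open>k = c - 1\<close> and conjugate back.
  The indices are shifted by \<open>c\<close> so that all exponents are natural numbers.
\<close>

lemma conj_meet_pow_invariant:
  fixes h x :: "'g::lattice_group"
  assumes E: "engel c TYPE('g)" and c: "c > 0" and x: "0 \<le> x"
  defines "z \<equiv> (conj_meet h ^^ c) x"
  shows "dominated (conj_by h z) z" "dominated (conj_by (- h) z) z"
proof -
  have z: "0 \<le> z" by (simp add: z_def conj_meet_pow_nonneg x)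
  have *: "dominated ((conj_by h ^^ k) z) ((conj_by h ^^ c) z)" for k
  proof -
    have "dominated ((conj_by h ^^ k) z) ((conj_by h ^^ j) ((conj_by h ^^ c) x))" if "j \<le> c" for j
    proof (rule engel_orbit_dominated[OF E z, of j])
      fix i assume i: "j \<le> i" "i < j + c"
      have "(conj_by h ^^ i) z \<le> (conj_by h ^^ (c + j - i)) ((conj_by h ^^ i) x)"
        unfolding z_def conj_pow_conj_meet_pow using i by (intro conj_meet_pow_le) simp
      also have "\<dots> = (conj_by h ^^ (c + j - i + i)) x" by (simp only: funpow_add o_apply)
      also have "c + j - i + i = j + c" using i by simp
      also have "(conj_by h ^^ (j + c)) x = (conj_by h ^^ j) ((conj_by h ^^ c) x)"
        by (simp only: funpow_add o_apply)
      finally show "dominated ((conj_by h ^^ i) z) ((conj_by h ^^ j) ((conj_by h ^^ c) x))"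
        by (rule le_imp_dominated)
    qed
    then show ?thesis
      using dominated_conj_meet_pow[OF conj_pow_nonneg[OF z] conj_pow_nonneg[OF x], of c k h h c h]
      by (simp add: z_def conj_pow_conj_meet_pow[of c])
  qed
  show "dominated (conj_by h z) z"
    using *[of "c + 1"] dominated_conj_pow_iff[of c h "conj_by h z" z] by (simp add: funpow_swap1)
  obtain c' where c': "c = Suc c'" using c by (cases c) auto
  have "dominated z (conj_by h z)"
    using *[of c'] dominated_conj_pow_iff[of c' h z "conj_by h z"] c' by (simp add: funpow_swap1)
  then show "dominated (conj_by (- h) z) z"
    using dominated_conj_by[of z "conj_by h z" "- h"] by (simp add: conj_by_cancel)
qed

text \<open>
  Let \<open>g\<close> be the \<open>d\<close>-th multiple of \<open>h\<close>. All iterated commutators of \<open>z\<close> with \<open>g\<close> stay in the convex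
  subgroup of \<open>z\<close>. The last nonzero one would commute with \<open>g\<close>, hence with \<open>h\<close>, and so would
  belong also to the convex subgroup of the conjugate of \<open>z\<close> by \<open>h\<close>, which meets the former
  only in \<open>0\<close>.
\<close>

lemma periodic_disjoint_eq_0:
  fixes z :: "'g::lattice_group"
  assumes E: "engel c TYPE('g)" and d: "d > 0" and "dominated (conj_by (multiple d h) z) z"
    and disj: "inf z (conj_by h z) = 0"
  shows "z = 0"
proof -
  define g where "g = multiple d h"
  have z: "0 \<le> z" using disj by (metis inf.cobounded1)
  have bounded: "(commutator g ^^ n) z \<in> bounded_by z" for n
  proof (induction n)
    case 0
    then show ?case by (simp add: nonneg_in_bounded_by z le_imp_dominated)
  next
    case (Suc n)
    have "conj_by g ((commutator g ^^ n) z) \<in> bounded_by z"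
      using conj_by_in_bounded_by[OF Suc, of g] assms(3) bounded_by_trans by (auto simp: g_def)
    then have "- (commutator g ^^ n) z + conj_by g ((commutator g ^^ n) z) \<in> bounded_by z"
      by (intro add_subgroupD[OF add_subgroup_bounded_by] Suc)
    then show ?case by (simp add: commutator_def[of _ "(commutator g ^^ n) z"])
  qed
  have "(commutator g ^^ n) z = 0" if "n \<le> c" for n
    using that
  proof (induction n rule: inc_induct)
    case base
    then show ?case using E by (simp add: engel_def)
  next
    case (step n)
    define u where "u = (commutator g ^^ n) z"
    have "conj_by g u = u" using step.IH by (simp add: u_def commutator_eq_0_iff)
    then have "conj_by h u = u"
      using commutes_with_root[OF E d] by (simp add: g_def conj_by_by_multiple)
    then have "u \<in> bounded_by (conj_by h z)"
      using conj_by_in_bounded_by[OF bounded, of h n] by (simp add: u_def)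
    then show ?case
      using bounded_by_disjoint[OF disj] bounded by (simp add: u_def)
  qed
  from this[of 0] show ?thesis by simp
qed

lemma disjoint_sum_list:
  fixes a :: "'g::lattice_group"
  assumes "0 \<le> a" "\<And>b. b \<in> set bs \<Longrightarrow> inf a b = 0"
  shows "inf a (sum_list bs) = 0"
  using assms(2)
proof (induction bs)
  case Nil
  then show ?case using assms by (simp add: inf.absorb2)
next
  case (Cons b bs)
  have *: "inf a b = 0" "inf a (sum_list bs) = 0" using Cons by simp_all
  then have "0 \<le> b" "0 \<le> sum_list bs" by (metis inf.cobounded2)+
  then have "inf a (b + sum_list bs) \<le> 0" "0 \<le> b + sum_list bs"
    using inf_add_le[of a b "sum_list bs"] lattice_group_add_mono[of 0 b 0] assms(1) * by simp_all
  then show ?case using assms(1) by (intro antisym) simp_all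
qed

lemma le_sum_list:
  fixes a :: "'g::lattice_group"
  assumes "a \<in> set bs" "\<And>b. b \<in> set bs \<Longrightarrow> 0 \<le> b"
  shows "a \<le> sum_list bs"
  using assms
proof (induction bs)
  case (Cons b bs)
  have "0 \<le> sum_list bs"
    using Cons.prems(2) by (induction bs) (use lattice_group_add_mono[of 0 _ 0] in auto)
  then show ?case
    using Cons lattice_group_add_mono[of b b 0 "sum_list bs"]
      lattice_group_add_mono[of 0 b a "sum_list bs"] by auto
qed simp

text \<open>
  Here \<open>y\<^sub>c\<close> is disjoint from \<open>y\<^sub>0, \<dots>, y\<^sub>c\<^sub>-\<^sub>1\<close>, hence from their sum, but by the Engel condition it
  lies in the convex subgroup generated by that sum.
\<close>

lemma disjoint_from_c_conjugates_eq_0: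
  fixes y :: "'g::lattice_group"
  assumes E: "engel c TYPE('g)" and y: "0 \<le> y"
    and disj: "\<And>j. 1 \<le> j \<Longrightarrow> j \<le> c \<Longrightarrow> inf y ((conj_by h ^^ j) y) = 0"
  shows "y = 0"
proof -
  define ys where "ys = map (\<lambda>i. (conj_by h ^^ i) y) [0..<c]"
  define yc where "yc = (conj_by h ^^ c) y"
  have nonneg: "0 \<le> yc" by (simp add: yc_def conj_pow_nonneg y)
  have "inf yc b = 0" if b: "b \<in> set ys" for b
  proof -
    obtain i where i: "i < c" "b = (conj_by h ^^ i) y" using b by (auto simp: ys_def)
    then have "yc = (conj_by h ^^ i) ((conj_by h ^^ (c - i)) y)"
      using funpow_add[of i "c - i" "conj_by h"] by (simp add: yc_def)
    then have "inf yc b = (conj_by h ^^ i) (inf y ((conj_by h ^^ (c - i)) y))"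
      using i by (simp add: conj_pow_inf inf.commute)
    then show ?thesis using disj[of "c - i"] i by (simp add: conj_pow_zero)
  qed
  then have "inf yc (sum_list ys) = 0" by (rule disjoint_sum_list[OF nonneg])
  moreover have "dominated yc (sum_list ys)"
    unfolding yc_def
  proof (rule engel_orbit_dominated[OF E y, of 0])
    fix i assume "i < 0 + c"
    then show "dominated ((conj_by h ^^ i) y) (sum_list ys)"
      by (intro le_imp_dominated le_sum_list) (auto simp: ys_def conj_pow_nonneg y)
  qed
  ultimately have "inf yc yc = 0" using disjoint_dominated nonneg by blast
  then have "(conj_by h ^^ c) y = 0" by (simp add: yc_def)
  moreover have "y = 0" if "(conj_by h ^^ n) y = 0" for n
    using that
  proof (induction n)
    case (Suc n)
    then show ?case using conj_by_cancel(1)[of h "(conj_by h ^^ n) y"] by (simp add: conj_by_zero)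
  qed simp
  ultimately show ?thesis by blast
qed

text \<open>
  Downward induction on \<open>d\<close>; for large \<open>d\<close> the preceding lemma applies. Let \<open>g\<close> be the \<open>d\<close>-th multiple
  of \<open>h\<close>. By the induction hypothesis an element below \<open>y\<close> that is disjoint also from its
  conjugate by \<open>g\<close> is \<open>0\<close>. The iterated meet of \<open>y\<close> with its conjugates by \<open>g\<close> eventually has a convex
  subgroup invariant under \<open>g\<close> and is \<open>0\<close> because \<open>y\<close> and \<open>y\<^sub>1\<close> are disjoint (this is where \<open>d \<ge> 2\<close>
  matters). Going back, each meet in the iteration is disjoint from its conjugate by \<open>g\<close> and
  hence \<open>0\<close>, down to \<open>y\<close> itself.
\<close>

lemma disjoint_conjugates_eq_0:
  fixes y :: "'g::lattice_group"
  assumes E: "engel c TYPE('g)" and d: "2 \<le> d" and y: "0 \<le> y"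
    and disj: "\<And>j. 1 \<le> j \<Longrightarrow> j < d \<Longrightarrow> inf y ((conj_by h ^^ j) y) = 0"
  shows "y = 0"
proof (cases "d \<le> c + 2")
  case True
  then show ?thesis using d y disj
  proof (induction d arbitrary: y rule: inc_induct)
    case base
    show ?case by (rule disjoint_from_c_conjugates_eq_0[OF E base(2), of h]) (use base(3) in auto)
  next
    case (step d)
    define g where "g = multiple d h"
    have g: "conj_by g = conj_by h ^^ d" by (rule ext) (simp add: g_def conj_by_by_multiple)
    \<comment> \<open>Disjointness from the first \<open>d - 1\<close> conjugates is inherited by elements below \<open>y\<close>.\<close>
    have below: "w = 0" if w: "0 \<le> w" "w \<le> y" "inf w (conj_by g w) = 0" for w
    proof (rule step.IH)
      fix j assume j: "1 \<le> j" "j < Suc d"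
      show "inf w ((conj_by h ^^ j) w) = 0"
      proof (cases "j = d")
        case False
        then have "inf w ((conj_by h ^^ j) w) \<le> 0"
          using step.prems(3)[of j] j inf_mono[OF w(2) conj_pow_mono[OF w(2)]] by (metis less_SucE)
        then show ?thesis using w(1) by (intro antisym) (simp_all add: conj_pow_nonneg)
      qed (use w g in simp)
    qed (use step w in auto)
    define z where "z = (conj_meet g ^^ Suc c) y"
    have "z \<le> y" using conj_meet_pow_le[of 0 "Suc c" g y] by (simp add: z_def)
    have z: "0 \<le> z" unfolding z_def by (rule conj_meet_pow_nonneg[OF step.prems(2)])
    have "inf z (conj_by h z) \<le> inf y (conj_by h y)"
      using \<open>z \<le> y\<close> conj_by_mono by (intro inf_mono)
    also have "\<dots> = 0" using step.prems(3)[of 1] step.prems(1) by simp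
    finally have "inf z (conj_by h z) = 0" using z by (intro antisym) (simp_all add: conj_by_nonneg)
    moreover have "dominated (conj_by g z) z"
      unfolding z_def by (rule conj_meet_pow_invariant[OF engel_mono[OF E]]) (use step.prems in auto)
    ultimately have "z = 0"
      using periodic_disjoint_eq_0[OF E, of d h z] step.prems(1) by (simp add: g_def)
    have "(conj_meet g ^^ m) y = 0" if "m \<le> Suc c" for m
      using that
    proof (induction m rule: inc_induct)
      case base
      then show ?case using \<open>z = 0\<close> by (simp only: z_def)
    next
      case (step m)
      show ?case
      proof (rule below)
        show "0 \<le> (conj_meet g ^^ m) y" by (rule conj_meet_pow_nonneg[OF \<open>0 \<le> y\<close>])
        show "(conj_meet g ^^ m) y \<le> y" using conj_meet_pow_le[of 0 m g y] by simp
        show "inf ((conj_meet g ^^ m) y) (conj_by g ((conj_meet g ^^ m) y)) = 0"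
          using step.IH by (simp only: conj_meet_Suc)
      qed
    qed
    from this[of 0] show ?case by simp
  qed
next
  case False
  show ?thesis by (rule disjoint_from_c_conjugates_eq_0[OF E y, of h]) (use False disj in auto)
qed

text \<open>
  With \<open>z\<close> the meet of \<open>x\<^sub>0, \<dots>, x\<^sub>c\<^sub>+\<^sub>1\<close>, the aim is that \<open>z\<close> dominates \<open>x\<close>, by downward induction on the
  length of the meets \<open>w\<close>. Let \<open>t\<close> be the join of the overlaps of \<open>w\<close> with its conjugates by \<open>h\<close> and
  by \<open>- h\<close>. The first overlap is the next longer meet and the second is its conjugate by \<open>- h\<close>,
  so \<open>z\<close>, whose convex subgroup is invariant, dominates \<open>t\<close>. The difference \<open>w - t\<close> is
  disjoint from its conjugate by \<open>h\<close>, so \<open>w = t\<close>. Taking \<open>c + 1\<close> conjugates rather than \<open>c\<close>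
  ensures that the number is positive.
\<close>

lemma conj_by_dominated:
  fixes x :: "'g::lattice_group"
  assumes E: "engel c TYPE('g)" and x: "0 \<le> x"
  shows "dominated (conj_by h x) x"
proof -
  define z where "z = (conj_meet h ^^ Suc c) x"
  have inv: "dominated (conj_by h z) z" "dominated (conj_by (- h) z) z"
    unfolding z_def using conj_meet_pow_invariant[OF engel_mono[OF E, of "Suc c"] _ x, of h] by auto
  have "dominated ((conj_meet h ^^ m) x) z" if "m \<le> Suc c" for m
    using that
  proof (induction m rule: inc_induct)
    case base
    then show ?case by (simp add: z_def le_imp_dominated)
  next
    case (step m)
    define w where "w = (conj_meet h ^^ m) x"
    have w: "0 \<le> w" by (simp add: w_def conj_meet_pow_nonneg x)
    define s where "s = inf w (conj_by h w)"
    define r where "r = inf w (conj_by (- h) w)"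
    define t where "t = sup s r"
    have nonneg: "0 \<le> s" "0 \<le> r" using w by (simp_all add: s_def r_def conj_by_nonneg)
    have conj_r: "conj_by h r = s" by (simp add: r_def s_def conj_by_inf conj_by_cancel inf.commute)
    then have r: "r = conj_by (- h) s" by (metis conj_by_cancel(1))
    have "dominated s z" using step.IH by (simp only: s_def w_def conj_meet_Suc)
    moreover from this have "dominated r z"
      unfolding r by (rule dominated_trans[OF dominated_conj_by inv(2)])
    ultimately have t: "dominated t z" unfolding t_def by (intro dominated_sup nonneg)
    define y where "y = w + - t"
    have "t \<le> w" by (simp add: t_def s_def r_def)
    then have y: "0 \<le> y" using add_right_isotone[of t w "- t"] by (simp add: y_def)
    \<comment> \<open>Removing a larger element than the overlap \<open>s\<close> from \<open>w\<close> and from its conjugate leaves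
      disjoint elements; for the conjugate this holds because \<open>t\<close> is also above \<open>r\<close>.\<close>
    have "y \<le> w + - s"
      unfolding y_def by (rule add_left_isotone) (simp add: lattice_group_uminus_le_iff t_def)
    moreover have "s \<le> conj_by h t"
      using conj_by_mono[of r t h] by (simp add: t_def conj_r)
    then have "conj_by h y \<le> conj_by h w + - s"
      unfolding y_def conj_by_add conj_by_uminus
      by (intro add_left_isotone) (simp add: lattice_group_uminus_le_iff)
    ultimately have "inf y (conj_by h y) \<le> inf w (conj_by h w) + - s"
      unfolding lattice_group_add_inf_distrib_right by (rule inf_mono)
    then have "inf y (conj_by h y) \<le> 0" by (simp add: s_def)
    then have "inf y (conj_by h y) = 0" using y by (intro antisym) (simp_all add: conj_by_nonneg)
    then have "inf y ((conj_by h ^^ j) y) = 0" if "1 \<le> j" "j < 2" for j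
      using that by (simp add: less_2_cases_iff)
    then have "y = 0" using disjoint_conjugates_eq_0[OF E order_refl y, of h] by blast
    then have "w = t" by (simp add: y_def)
    then show ?case using t by (simp add: w_def)
  qed
  from this[of 0] have "dominated x z" by simp
  then have "dominated (conj_by h x) z"
    by (rule dominated_trans[OF dominated_conj_by inv(1)])
  moreover have "z \<le> x" using conj_meet_pow_le[of 0 "Suc c" h x] by (simp add: z_def)
  ultimately show ?thesis using dominated_trans le_imp_dominated by blast
qed

section \<open>Cancellative residuated lattices as ordered monoids\<close>

lemma residuated_mult_right_mono: "a \<le> b \<Longrightarrow> a * c \<le> b * (c::'a::residuated_lattice)"
  by (meson order_refl order_trans rres_residual)

lemma residuated_mult_left_mono: "a \<le> b \<Longrightarrow> c * a \<le> c * (b::'a::residuated_lattice)"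
  by (meson order_refl order_trans lres_residual)

lemma residuated_sup_mult: "sup a b * c = sup (a * c) (b * (c::'a::residuated_lattice))"
proof (rule antisym)
  show "sup a b * c \<le> sup (a * c) (b * c)"
    by (simp add: rres_residual) (simp flip: rres_residual)
qed (simp add: residuated_mult_right_mono)

lemma cancellative_lcancel:
  assumes "cancellative TYPE('a)"
  shows "a * b = a * c \<longleftrightarrow> b = (c::'a::monoid_mult)"
  using assms unfolding cancellative_def by blast

lemma cancellative_rcancel:
  assumes "cancellative TYPE('a)"
  shows "b * a = c * a \<longleftrightarrow> b = (c::'a::monoid_mult)"
  using assms unfolding cancellative_def by blast

text \<open>
  Multiplication distributes over joins, so order cancellation is cancellation applied to \<open>a \<squnion> b\<close> and
  \<open>b\<close>.
\<close>

lemma cancellative_le_rcancel: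
  fixes a b c :: "'a::residuated_lattice"
  assumes "cancellative TYPE('a)"
  shows "a * c \<le> b * c \<longleftrightarrow> a \<le> b"
proof
  assume "a * c \<le> b * c"
  then have "sup a b * c = b * c" by (simp add: residuated_sup_mult sup.absorb2)
  then have "sup a b = b" by (simp add: cancellative_rcancel[OF assms])
  then show "a \<le> b" by (simp add: le_iff_sup)
qed (rule residuated_mult_right_mono)

lemma cancellative_le_lcancel:
  fixes a b c :: "'a::residuated_lattice"
  assumes "cancellative TYPE('a)"
  shows "c * a \<le> c * b \<longleftrightarrow> a \<le> b"
proof
  have "c * sup a b = sup (c * a) (c * b)"
  proof (rule antisym)
    show "c * sup a b \<le> sup (c * a) (c * b)"
      by (simp add: lres_residual) (simp flip: lres_residual)
  qed (simp add: residuated_mult_left_mono)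
  moreover assume "c * a \<le> c * b"
  ultimately have "c * sup a b = c * b" by (simp add: sup.absorb2)
  then have "sup a b = b" by (simp add: cancellative_lcancel[OF assms])
  then show "a \<le> b" by (simp add: le_iff_sup)
qed (rule residuated_mult_left_mono)

section \<open>The lattice-ordered group of fractions\<close>

definition has_fractions :: "'a::monoid_mult itself \<Rightarrow> bool" where
  "has_fractions T \<longleftrightarrow> cancellative T \<and> (\<forall>a b::'a. \<exists>s t. a * s = b * t)"

lemma has_fractionsD:
  assumes "has_fractions TYPE('a::monoid_mult)"
  shows "cancellative TYPE('a)" "\<exists>s t. a * s = b * (t::'a)"
  using assms by (simp_all add: has_fractions_def)

text \<open>
  The pair \<open>(a, b)\<close> stands for \<open>a b\<^sup>-\<^sup>1\<close>. When a common right multiple is missing or cancellation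
  fails, all pairs are identified: the fractions then form a trivial group, and they are a
  lattice-ordered group over every residuated lattice, as a type class instance demands.
\<close>

definition same_fraction :: "'a::monoid_mult \<times> 'a \<Rightarrow> 'a \<times> 'a \<Rightarrow> bool" where
  "same_fraction p q \<longleftrightarrow> (has_fractions TYPE('a) \<longrightarrow>
     (\<exists>s t. fst p * s = fst q * t \<and> snd p * s = snd q * t))"

text \<open>
  Comparing the numerators of two fractions after expansion to a common denominator does not
  depend on the expansion: two expansions have a common expansion, and right factors cancel.
\<close>

lemma fraction_le_any_denominator:
  fixes a b c d :: "'a::residuated_lattice"
  assumes ok: "has_fractions TYPE('a)"
    and "b * s = d * t" "a * s \<le> c * t" "b * s' = d * t'"
  shows "a * s' \<le> c * t'"
proof -
  note cancel = cancellative_lcancel[OF has_fractionsD(1)[OF ok]]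
  obtain p q where pq: "s * p = s' * q" using has_fractionsD(2)[OF ok] by blast
  have "d * (t * p) = b * (s * p)" by (simp add: assms(2) flip: mult.assoc)
  also have "\<dots> = d * (t' * q)" unfolding pq by (simp add: assms(4) flip: mult.assoc)
  finally have tp: "t * p = t' * q" by (simp add: cancel)
  have "(a * s') * q = (a * s) * p" by (simp add: pq mult.assoc)
  also have "\<dots> \<le> (c * t) * p" by (rule residuated_mult_right_mono) fact
  also have "\<dots> = (c * t') * q" by (simp add: tp mult.assoc)
  finally show ?thesis by (simp add: cancellative_le_rcancel[OF has_fractionsD(1)[OF ok]])
qed

lemma fraction_eq_any_denominator:
  fixes a b c d :: "'a::residuated_lattice"
  assumes "has_fractions TYPE('a)"
    and "b * s = d * t" "a * s = c * t" "b * s' = d * t'"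
  shows "a * s' = c * t'"
  using fraction_le_any_denominator[of b s d t a c s' t']
    fraction_le_any_denominator[of d t b s c a t' s'] assms by (simp add: antisym)

quotient_type (overloaded) 'a fraction = "'a::residuated_lattice \<times> 'a" / same_fraction
proof (rule equivpI)
  show "reflp (same_fraction :: 'a \<times> 'a \<Rightarrow> _)"
    by (auto simp: reflp_def same_fraction_def)
  show "symp (same_fraction :: 'a \<times> 'a \<Rightarrow> _)"
    by (auto simp: symp_def same_fraction_def) metis
  show "transp (same_fraction :: 'a \<times> 'a \<Rightarrow> _)"
  proof (rule transpI)
    fix x y z :: "'a \<times> 'a"
    assume xy: "same_fraction x y" and yz: "same_fraction y z"
    show "same_fraction x z"
      unfolding same_fraction_def
    proof
      assume ok: "has_fractions TYPE('a)"
      obtain s t where st: "fst x * s = fst y * t" "snd x * s = snd y * t"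
        using xy ok by (auto simp: same_fraction_def)
      obtain u v where uv: "fst y * u = fst z * v" "snd y * u = snd z * v"
        using yz ok by (auto simp: same_fraction_def)
      obtain p q where pq: "t * p = u * q" using has_fractionsD(2)[OF ok] by blast
      have "fst x * (s * p) = fst z * (v * q)" "snd x * (s * p) = snd z * (v * q)"
        by (metis st uv pq mult.assoc)+
      then show "\<exists>s t. fst x * s = fst z * t \<and> snd x * s = snd z * t" by blast
    qed
  qed
qed

lift_definition frac :: "'a::residuated_lattice \<Rightarrow> 'a \<Rightarrow> 'a fraction" is Pair .

lemma frac_cases: obtains a b where "x = frac a b"
proof -
  have "\<exists>a b. x = frac a b" by transfer (auto simp: same_fraction_def)
  then show thesis using that by blast
qed

lemma frac_eq_iff:
  "has_fractions TYPE('a) \<Longrightarrow>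
     frac a b = frac c (d::'a::residuated_lattice) \<longleftrightarrow> (\<exists>s t. a * s = c * t \<and> b * s = d * t)"
  by transfer (simp add: same_fraction_def)

lemma fraction_collapse:
  fixes x y :: "'a::residuated_lattice fraction"
  assumes "\<not> has_fractions TYPE('a)"
  shows "x = y"
proof -
  have "frac a b = frac c d" for a b c d :: 'a
    by transfer (simp add: same_fraction_def assms)
  then show ?thesis by (metis frac_cases)
qed

lemma frac_expand: "frac (a * s) (b * s) = frac a (b::'a::residuated_lattice)"
proof (cases "has_fractions TYPE('a)")
  case True
  have "a * s * 1 = a * s \<and> b * s * 1 = b * s" by simp
  then show ?thesis unfolding frac_eq_iff[OF True] by blast
qed (rule fraction_collapse)

lemma frac_common_denominator:
  fixes x y :: "'a::residuated_lattice fraction"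
  obtains a b d where "x = frac a d" "y = frac b d"
proof (cases "has_fractions TYPE('a)")
  case True
  obtain a b c d where xy: "x = frac a b" "y = frac c d" by (metis frac_cases)
  obtain s t where "b * s = d * t" using has_fractionsD(2)[OF True] by blast
  then have "x = frac (a * s) (b * s)" "y = frac (c * t) (b * s)"
    using xy frac_expand by metis+
  then show thesis by (rule that)
next
  case False
  show thesis by (rule that[of 1 1 1]) (rule fraction_collapse[OF False])+
qed

text \<open>
  Expanding both fractions to make the denominator of the first equal to the numerator of the
  second turns multiplication into \<open>(a b\<^sup>-\<^sup>1) (b c\<^sup>-\<^sup>1) = a c\<^sup>-\<^sup>1\<close>. With three factors in this form,
  associativity is immediate.
\<close>

lemma frac_composable:
  fixes x y :: "'a::residuated_lattice fraction"
  obtains a b c where "x = frac a b" "y = frac b c"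
proof (cases "has_fractions TYPE('a)")
  case True
  obtain a b c d where xy: "x = frac a b" "y = frac c d" by (metis frac_cases)
  obtain s t where "b * s = c * t" using has_fractionsD(2)[OF True] by blast
  then have "x = frac (a * s) (b * s)" "y = frac (b * s) (d * t)"
    using xy frac_expand by metis+
  then show thesis by (rule that)
next
  case False
  show thesis by (rule that[of 1 1 1]) (rule fraction_collapse[OF False])+
qed

lemma frac_composable3:
  fixes x y z :: "'a::residuated_lattice fraction"
  obtains a b c d where "x = frac a b" "y = frac b c" "z = frac c d"
proof (cases "has_fractions TYPE('a)")
  case True
  obtain a b c where xy: "x = frac a b" "y = frac b c" by (rule frac_composable)
  obtain e f where z: "z = frac e f" by (metis frac_cases)
  obtain s t where "c * s = e * t" using has_fractionsD(2)[OF True] by blast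
  then have "x = frac (a * s) (b * s)" "y = frac (b * s) (c * s)" "z = frac (c * s) (f * t)"
    using xy z frac_expand by metis+
  then show thesis by (rule that)
next
  case False
  show thesis by (rule that[of 1 1 1 1]) (rule fraction_collapse[OF False])+
qed

lemma frac_compose_unique:
  fixes a b c a' b' c' :: "'a::residuated_lattice"
  assumes "frac a b = frac a' b'" "frac b c = frac b' c'"
  shows "frac a c = frac a' c'"
proof (cases "has_fractions TYPE('a)")
  case True
  obtain s t where st: "a * s = a' * t" "b * s = b' * t"
    using assms(1) frac_eq_iff[OF True] by blast
  obtain u v where uv: "b * u = b' * v" "c * u = c' * v"
    using assms(2) frac_eq_iff[OF True] by blast
  have "c * s = c' * t" by (rule fraction_eq_any_denominator[OF True uv st(2)])
  then show ?thesis using st frac_eq_iff[OF True] by blast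
qed (rule fraction_collapse)

lemma frac_inverse_unique:
  fixes a b a' b' :: "'a::residuated_lattice"
  assumes "frac a b = frac a' b'"
  shows "frac b a = frac b' a'"
proof (cases "has_fractions TYPE('a)")
  case True
  then show ?thesis using assms frac_eq_iff[OF True] by blast
qed (rule fraction_collapse)

lemma frac_self: "frac a a = frac 1 (1::'a::residuated_lattice)"
  using frac_expand[of 1 a 1] by simp

instantiation fraction :: (residuated_lattice) group_add
begin

definition zero_fraction :: "'a fraction" where "zero_fraction = frac 1 1"

definition plus_fraction :: "'a fraction \<Rightarrow> 'a fraction \<Rightarrow> 'a fraction" where
  "plus_fraction x y = (SOME z. \<exists>a b c. x = frac a b \<and> y = frac b c \<and> z = frac a c)"

definition uminus_fraction :: "'a fraction \<Rightarrow> 'a fraction" where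
  "uminus_fraction x = (SOME z. \<exists>a b. x = frac a b \<and> z = frac b a)"

definition minus_fraction :: "'a fraction \<Rightarrow> 'a fraction \<Rightarrow> 'a fraction" where
  "minus_fraction x y = x + - y"

lemma frac_add: "frac a b + frac b c = frac a (c::'a)"
  unfolding plus_fraction_def
proof (rule someI2)
  show "\<exists>a' b' c'. frac a b = frac a' b' \<and> frac b c = frac b' c' \<and> frac a c = frac a' c'"
    by blast
qed (metis frac_compose_unique)

lemma frac_uminus: "- frac a b = frac b (a::'a)"
  unfolding uminus_fraction_def
proof (rule someI2)
  show "\<exists>a' b'. frac a b = frac a' b' \<and> frac b a = frac b' a'"
    by blast
qed (metis frac_inverse_unique)

instance
proof
  fix x y z :: "'a fraction"
  show "x + y + z = x + (y + z)"
    by (rule frac_composable3[of x y z]) (simp add: frac_add)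
  obtain a b where x: "x = frac a b" by (rule frac_cases)
  show "0 + x = x" unfolding zero_fraction_def x frac_self[of a, symmetric] by (rule frac_add)
  show "x + 0 = x" unfolding zero_fraction_def x frac_self[of b, symmetric] by (rule frac_add)
  show "- x + x = 0" unfolding x zero_fraction_def frac_uminus frac_add by (rule frac_self)
  show "x + - y = x - y" by (simp add: minus_fraction_def)
qed

end

instantiation fraction :: (residuated_lattice) lattice_group
begin

definition less_eq_fraction :: "'a fraction \<Rightarrow> 'a fraction \<Rightarrow> bool" where
  "less_eq_fraction x y \<longleftrightarrow> (\<exists>a b d. x = frac a d \<and> y = frac b d \<and> a \<le> b)"

definition less_fraction :: "'a fraction \<Rightarrow> 'a fraction \<Rightarrow> bool" where
  "less_fraction x y \<longleftrightarrow> x \<le> y \<and> \<not> y \<le> x"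

definition sup_fraction :: "'a fraction \<Rightarrow> 'a fraction \<Rightarrow> 'a fraction" where
  "sup_fraction x y = (SOME z. \<exists>a b d. x = frac a d \<and> y = frac b d \<and> z = frac (sup a b) d)"

definition inf_fraction :: "'a fraction \<Rightarrow> 'a fraction \<Rightarrow> 'a fraction" where
  "inf_fraction x y = - sup (- x) (- y)"

lemma fraction_le_collapse:
  fixes x y :: "'a fraction"
  assumes "\<not> has_fractions TYPE('a)"
  shows "x \<le> y"
  unfolding less_eq_fraction_def using fraction_collapse[OF assms] by blast

lemma frac_le_iff:
  fixes a b c d s t :: 'a
  assumes ok: "has_fractions TYPE('a)" and st: "b * s = d * t"
  shows "frac a b \<le> frac c d \<longleftrightarrow> a * s \<le> c * t"
proof
  assume "frac a b \<le> frac c d"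
  then obtain p q r where pqr: "frac a b = frac p r" "frac c d = frac q r" "p \<le> q"
    by (auto simp: less_eq_fraction_def)
  obtain k l where kl: "a * k = p * l" "b * k = r * l"
    using pqr(1) frac_eq_iff[OF ok] by blast
  obtain m n where mn: "c * m = q * n" "d * m = r * n"
    using pqr(2) frac_eq_iff[OF ok] by blast
  obtain i j where ij: "l * i = n * j" using has_fractionsD(2)[OF ok] by blast
  show "a * s \<le> c * t"
  proof (rule fraction_le_any_denominator[OF ok _ _ st])
    show "b * (k * i) = d * (m * j)" by (metis kl(2) mn(2) ij mult.assoc)
    have "a * (k * i) = p * (l * i)" by (simp add: kl(1) flip: mult.assoc)
    also have "\<dots> \<le> q * (l * i)" using pqr(3) by (rule residuated_mult_right_mono)
    also have "\<dots> = c * (m * j)" by (simp add: ij mn(1) flip: mult.assoc)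
    finally show "a * (k * i) \<le> c * (m * j)" .
  qed
next
  assume "a * s \<le> c * t"
  moreover have "frac a b = frac (a * s) (b * s)" "frac c d = frac (c * t) (b * s)"
    using frac_expand st by metis+
  ultimately show "frac a b \<le> frac c d"
    unfolding less_eq_fraction_def by blast
qed

lemma frac_le_common_iff:
  "has_fractions TYPE('a) \<Longrightarrow> frac a d \<le> frac b d \<longleftrightarrow> a \<le> (b::'a)"
  using frac_le_iff[of d 1 d 1 a b] by simp

lemma fraction_le_refl: "x \<le> (x :: 'a fraction)"
  by (rule frac_cases[of x]) (auto simp: less_eq_fraction_def)

lemma fraction_le_trans:
  fixes x y z :: "'a fraction"
  assumes "x \<le> y" "y \<le> z"
  shows "x \<le> z"
proof (cases "has_fractions TYPE('a)")
  case ok: True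
  obtain a b d where xy: "x = frac a d" "y = frac b d" by (rule frac_common_denominator)
  obtain c e where z: "z = frac c e" by (rule frac_cases)
  obtain s t where st: "d * s = e * t" using has_fractionsD(2)[OF ok] by blast
  have "a \<le> b" using assms(1) by (simp add: xy frac_le_common_iff[OF ok])
  then have "a * s \<le> b * s" by (rule residuated_mult_right_mono)
  also have "b * s \<le> c * t" using assms(2) by (simp add: xy z frac_le_iff[OF ok st])
  finally show ?thesis by (simp add: xy z frac_le_iff[OF ok st])
qed (rule fraction_le_collapse)

lemma fraction_le_antisym:
  fixes x y :: "'a fraction"
  assumes "x \<le> y" "y \<le> x"
  shows "x = y"
proof (cases "has_fractions TYPE('a)")
  case ok: True
  obtain a b d where "x = frac a d" "y = frac b d" by (rule frac_common_denominator)
  then show ?thesis using assms by (simp add: frac_le_common_iff[OF ok])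
qed (rule fraction_collapse)

lemma fraction_add_left_isotone:
  fixes x y z :: "'a fraction"
  assumes "x \<le> y"
  shows "z + x \<le> z + y"
proof (cases "has_fractions TYPE('a)")
  case ok: True
  obtain a b d where xy: "x = frac a d" "y = frac b d" by (rule frac_common_denominator)
  have "a \<le> b" using assms by (simp add: xy frac_le_common_iff[OF ok])
  obtain u v where z: "z = frac u v" by (rule frac_cases)
  obtain s t where st: "v * s = a * t" using has_fractionsD(2)[OF ok] by blast
  obtain s' t' where st': "v * s' = b * t'" using has_fractionsD(2)[OF ok] by blast
  obtain m n where mn: "t * m = t' * n" using has_fractionsD(2)[OF ok] by blast
  have sum: "z + w = frac (u * p) (d * q)" if "w = frac e d" "v * p = e * q" for w e p q
  proof -
    have "z = frac (u * p) (v * p)" "w = frac (v * p) (d * q)"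
      using that z frac_expand by metis+
    then show ?thesis by (simp add: frac_add)
  qed
  have "v * (s * m) = a * (t' * n)" by (simp add: st flip: mult.assoc mn)
  also have "\<dots> \<le> b * (t' * n)" using \<open>a \<le> b\<close> by (rule residuated_mult_right_mono)
  also have "\<dots> = v * (s' * n)" by (simp add: st' flip: mult.assoc)
  finally have "s * m \<le> s' * n"
    by (simp add: cancellative_le_lcancel[OF has_fractionsD(1)[OF ok]])
  then have "u * s * m \<le> u * s' * n" unfolding mult.assoc by (rule residuated_mult_left_mono)
  moreover have "d * t * m = d * t' * n" by (simp add: mn mult.assoc)
  ultimately show ?thesis
    by (simp add: sum[OF xy(1) st] sum[OF xy(2) st'] frac_le_iff[OF ok])
qed (rule fraction_le_collapse)

lemma fraction_add_right_isotone:
  fixes x y z :: "'a fraction"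
  assumes "x \<le> y"
  shows "x + z \<le> y + z"
proof (cases "has_fractions TYPE('a)")
  case ok: True
  obtain a b d where xy: "x = frac a d" "y = frac b d" by (rule frac_common_denominator)
  have "a \<le> b" using assms by (simp add: xy frac_le_common_iff[OF ok])
  obtain u v where z: "z = frac u v" by (rule frac_cases)
  obtain s t where st: "d * s = u * t" using has_fractionsD(2)[OF ok] by blast
  have "w + z = frac (e * s) (v * t)" if "w = frac e d" for w e
  proof -
    have "w = frac (e * s) (d * s)" "z = frac (d * s) (v * t)"
      using that z st frac_expand by metis+
    then show ?thesis by (simp add: frac_add)
  qed
  then show ?thesis
    using residuated_mult_right_mono[OF \<open>a \<le> b\<close>] xy by (simp add: frac_le_common_iff[OF ok])
qed (rule fraction_le_collapse)

lemma fraction_uminus_antitone: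
  fixes x y :: "'a fraction"
  assumes "x \<le> y"
  shows "- y \<le> - x"
  using fraction_add_right_isotone[OF fraction_add_left_isotone[OF assms, of "- x"], of "- y"]
  by (simp add: add.assoc)

lemma fraction_sup_upper:
  fixes x y :: "'a fraction"
  shows "x \<le> sup x y" "y \<le> sup x y"
proof -
  have "x \<le> sup x y \<and> y \<le> sup x y"
  proof (cases "has_fractions TYPE('a)")
    case ok: True
    show ?thesis
      unfolding sup_fraction_def
    proof (rule someI2_ex)
      show "\<exists>z a b d. x = frac a d \<and> y = frac b d \<and> z = frac (sup a b) d"
        by (rule frac_common_denominator[of x y]) blast
    qed (auto simp: frac_le_common_iff[OF ok])
  qed (simp add: fraction_le_collapse)
  then show "x \<le> sup x y" "y \<le> sup x y" by simp_all
qed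

lemma fraction_sup_least:
  fixes x y w :: "'a fraction"
  assumes "x \<le> w" "y \<le> w"
  shows "sup x y \<le> w"
proof (cases "has_fractions TYPE('a)")
  case ok: True
  show ?thesis
    unfolding sup_fraction_def
  proof (rule someI2_ex)
    show "\<exists>z a b d. x = frac a d \<and> y = frac b d \<and> z = frac (sup a b) d"
      by (rule frac_common_denominator[of x y]) blast
  next
    fix z
    assume "\<exists>a b d. x = frac a d \<and> y = frac b d \<and> z = frac (sup a b) d"
    then obtain a b d where xyz: "x = frac a d" "y = frac b d" "z = frac (sup a b) d" by blast
    obtain u v where w: "w = frac u v" by (rule frac_cases)
    obtain s t where st: "d * s = v * t" using has_fractionsD(2)[OF ok] by blast
    show "z \<le> w"
      using assms by (simp add: xyz w frac_le_iff[OF ok st] residuated_sup_mult)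
  qed
qed (rule fraction_le_collapse)

instance
proof
  fix x y z :: "'a fraction"
  have double: "u \<le> - v" if "v \<le> - u" for u v :: "'a fraction"
    using fraction_uminus_antitone[OF that] by simp
  show "x < y \<longleftrightarrow> x \<le> y \<and> \<not> y \<le> x" by (rule less_fraction_def)
  show "x \<le> x" by (rule fraction_le_refl)
  show "x \<le> y \<Longrightarrow> y \<le> z \<Longrightarrow> x \<le> z" by (rule fraction_le_trans)
  show "x \<le> y \<Longrightarrow> y \<le> x \<Longrightarrow> x = y" by (rule fraction_le_antisym)
  show "x \<le> sup x y" "y \<le> sup x y" by (rule fraction_sup_upper)+
  show "y \<le> x \<Longrightarrow> z \<le> x \<Longrightarrow> sup y z \<le> x" by (rule fraction_sup_least)
  show "inf x y \<le> x" "inf x y \<le> y"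
    unfolding inf_fraction_def
    using fraction_uminus_antitone[OF fraction_sup_upper(1), of "- x" "- y"]
      fraction_uminus_antitone[OF fraction_sup_upper(2), of "- x" "- y"] by simp_all
  show "x \<le> y \<Longrightarrow> x \<le> z \<Longrightarrow> x \<le> inf y z"
    unfolding inf_fraction_def by (rule double) (intro fraction_sup_least fraction_uminus_antitone)
  show "x \<le> y \<Longrightarrow> z + x \<le> z + y" by (rule fraction_add_left_isotone)
  show "x \<le> y \<Longrightarrow> x + z \<le> y + z" by (rule fraction_add_right_isotone)
qed

end

definition emb :: "'a::residuated_lattice \<Rightarrow> 'a fraction" where
  "emb a = frac a 1"

lemma emb_one: "emb 1 = 0"
  by (simp add: emb_def zero_fraction_def)

lemma emb_mult: "emb (a * b) = emb a + emb b"
proof -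
  have "emb a = frac (a * b) b" unfolding emb_def using frac_expand[of a b 1] by simp
  then show ?thesis by (simp add: emb_def frac_add)
qed

lemma frac_conv_emb: "frac a b = emb a - emb b"
  by (simp add: emb_def diff_conv_add_uminus frac_uminus frac_add del: add_uminus_conv_diff)

lemma emb_le_iff: "has_fractions TYPE('a) \<Longrightarrow> emb a \<le> emb b \<longleftrightarrow> a \<le> (b::'a::residuated_lattice)"
  by (simp add: emb_def frac_le_common_iff)

text \<open>
  The reason why laws for elements of the monoid extend to the whole group: the elements
  satisfying a commutation condition form a subgroup.
\<close>

lemma fraction_subgroup_generated_by_emb:
  assumes "add_subgroup S" "range emb \<subseteq> S"
  shows "x \<in> S"
proof -
  obtain a b where "x = emb a + - emb b" by (rule frac_cases[of x]) (simp add: frac_conv_emb)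
  moreover have "emb a \<in> S" "emb b \<in> S" using assms(2) by auto
  ultimately show ?thesis by (simp only: add_subgroupD[OF assms(1)])
qed

section \<open>Nilpotency of the group of fractions\<close>

primrec upper_central :: "nat \<Rightarrow> 'g::group_add set" where
  "upper_central 0 = {0}"
| "upper_central (Suc n) = {x. \<forall>h. commutator h x \<in> upper_central n}"

lemma commutator_add: "commutator h (x + y) = conj_by y (commutator h x) + commutator h y"
  by (simp only: commutator_def conj_by_def group_norm)

lemma commutator_uminus: "commutator h (- x) = conj_by (- x) (- commutator h x)"
  by (simp only: commutator_def conj_by_def group_norm)

lemma commutator_conj_by: "commutator h (conj_by k x) = conj_by k (commutator (k + h - k) x)"
  by (simp only: commutator_def conj_by_def group_norm diff_conv_add_uminus)

lemma commutator_by_add: "commutator (h + k) x = commutator k x + conj_by k (commutator h x)"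
  by (simp only: commutator_def conj_by_def group_norm)

lemma commutator_by_uminus: "commutator (- h) x = conj_by (- h) (- commutator h x)"
  by (simp only: commutator_def conj_by_def group_norm)

lemma upper_central_normal:
  fixes k x :: "'g::group_add"
  shows "add_subgroup (upper_central n :: 'g set)" "x \<in> upper_central n \<Longrightarrow> conj_by k x \<in> upper_central n"
proof (induction n arbitrary: x k)
  case 0
  { case 1 then show ?case by (simp add: add_subgroup_def) }
  { case 2 then show ?case by (simp add: conj_by_zero) }
next
  case (Suc n)
  { case 1
    show ?case
      using Suc add_subgroupD[OF Suc(1)]
      by (auto simp: add_subgroup_def commutator_add commutator_uminus commutator_def[of _ 0] conj_by_zero) }
  { case 2 then show ?case using Suc(2) by (simp add: commutator_conj_by) }
qed

lemma add_subgroup_central_mod: "add_subgroup {h. commutator h x \<in> upper_central n}"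
proof -
  have "commutator 0 x = 0" by (simp add: commutator_eq_0_iff conj_by_by_zero)
  then show ?thesis
    by (auto simp: add_subgroup_def commutator_by_add commutator_by_uminus
        intro: upper_central_normal(2) add_subgroupD[OF upper_central_normal(1)])
qed

lemma upper_central_imp_engel:
  assumes "\<And>x::'g::group_add. x \<in> upper_central c"
  shows "engel c TYPE('g)"
proof -
  have "(commutator h ^^ k) x \<in> upper_central (c - k)" if "k \<le> c" for h x :: 'g and k
    using that
  proof (induction k)
    case (Suc k)
    then have "(commutator h ^^ k) x \<in> upper_central (Suc (c - Suc k))" by (simp add: Suc_diff_Suc)
    then show ?case by simp
  qed (simp add: assms)
  from this[of c] show ?thesis by (simp add: engel_def)
qed

lemma q_term_starts_with: "\<exists>s. q_term (Suc n) x y z = x * s"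
proof (induction n arbitrary: x y)
  case (Suc n)
  obtain s where "q_term (Suc n) x y z = x * s" using Suc by blast
  then show ?case by (simp add: mult.assoc) blast
qed auto

text \<open>
  The variable with index \<open>m\<close> first occurs in the term with index \<open>m + 1\<close>, so it may be chosen
  freely after the shorter terms are fixed.
\<close>

lemma q_term_update: "n \<le> m \<Longrightarrow> q_term n x y (z(m := w)) = q_term n x y z"
  by (induction n x y z rule: q_term.induct) auto

lemma nilpotent_has_fractions:
  assumes "nilpotent TYPE('a::monoid_mult)" "cancellative TYPE('a)"
  shows "has_fractions TYPE('a)"
proof -
  obtain n where n: "c_nilpotent (Suc n) TYPE('a)"
    using assms(1) by (metis nilpotent_def Suc_le_D One_nat_def)
  have "\<exists>s t. a * s = b * t" for a b :: 'a
    using n q_term_starts_with[of n a b] q_term_starts_with[of n b a]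
    unfolding c_nilpotent_def by metis
  then show ?thesis using assms(2) by (simp add: has_fractions_def)
qed

definition q_law_mod :: "nat \<Rightarrow> nat \<Rightarrow> 'a::residuated_lattice itself \<Rightarrow> bool" where
  "q_law_mod n j T \<longleftrightarrow>
     (\<forall>(x::'a) y z. - emb (q_term n y x z) + emb (q_term n x y z) \<in> upper_central j)"

text \<open>
  Write \<open>u\<close> and \<open>v\<close> for the two sides of the shorter law and let the last variable \<open>z\<close> range over the
  monoid. The longer law says that \<open>u + w + v\<close> and \<open>v + w + u\<close> agree modulo the \<open>j\<close>-th term of the upper
  central series for all \<open>w\<close> in the monoid. Combining an arbitrary \<open>w\<close> with \<open>w = 0\<close>, one sees that
  \<open>- v + u\<close> commutes with \<open>w\<close> modulo this term, first for \<open>w\<close> in the monoid and then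
  for all \<open>w\<close> in the group.
\<close>

lemma q_law_mod_Suc:
  assumes law: "q_law_mod (Suc (Suc n)) j TYPE('a::residuated_lattice)"
  shows "q_law_mod (Suc n) (Suc j) TYPE('a)"
  unfolding q_law_mod_def
proof (intro allI)
  fix x y :: 'a and z
  define u where "u = emb (q_term (Suc n) x y z)"
  define v where "v = emb (q_term (Suc n) y x z)"
  note subgroup = add_subgroupD[OF upper_central_normal(1)[of j]]
  have swap: "v + - u + - w + - v + u + w \<in> upper_central j" if "w = emb b" for w b
  proof -
    have "- (v + w + u) + (u + w + v) \<in> upper_central j"
      using law[unfolded q_law_mod_def, rule_format, of y x "z(Suc n := b)"] that
      by (simp add: emb_mult q_term_update u_def v_def)
    from upper_central_normal(2)[OF this, of "- v"] show ?thesis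
      by (simp only: conj_by_def group_norm)
  qed
  have "commutator w (- v + u) \<in> upper_central j" if "w = emb b" for w b
  proof -
    \<comment> \<open>The summand for \<open>w = 0\<close> corrects for \<open>u\<close> and \<open>v\<close> commuting only modulo the series.\<close>
    have "commutator w (- v + u) = - (v + - u + - 0 + - v + u + 0) + (v + - u + - w + - v + u + w)"
      by (simp only: commutator_def conj_by_def group_norm)
    then show ?thesis using swap[OF that] swap[of 0 1] subgroup by (metis emb_one)
  qed
  then have "range emb \<subseteq> {w. commutator w (- v + u) \<in> upper_central j}" by auto
  then show "- v + u \<in> upper_central (Suc j)"
    using fraction_subgroup_generated_by_emb[OF add_subgroup_central_mod] by fastforce
qed

lemma nilpotent_imp_engel:
  assumes "nilpotent TYPE('a::residuated_lattice)"
  obtains c where "engel c TYPE('a fraction)"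
proof -
  obtain n where n: "c_nilpotent (Suc n) TYPE('a)"
    using assms by (metis nilpotent_def Suc_le_D One_nat_def)
  have "q_law_mod (Suc (n - j)) j TYPE('a)" if "j \<le> n" for j
    using that
  proof (induction j)
    case 0
    then show ?case using n unfolding q_law_mod_def c_nilpotent_def
      by (metis diff_zero left_minus singletonI upper_central.simps(1))
  next
    case (Suc j)
    then show ?case using q_law_mod_Suc[of "n - Suc j" j] by (simp add: Suc_diff_Suc)
  qed
  from this[of n] have law: "- emb (y * x) + emb (x * y) \<in> upper_central n" for x y :: 'a
    by (simp add: q_law_mod_def)
  have "commutator (emb y) (emb x) \<in> upper_central n" for x y :: 'a
    using law[of y x] by (simp add: emb_mult commutator_def conj_by_def group_norm del: add_uminus_conv_diff)
  then have "commutator h (emb x) \<in> upper_central n" for h and x :: 'a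
    using fraction_subgroup_generated_by_emb[OF add_subgroup_central_mod[of "emb x" n]] by fastforce
  then have "range emb \<subseteq> (upper_central (Suc n) :: 'a fraction set)" by auto
  then have "x \<in> upper_central (Suc n)" for x :: "'a fraction"
    using fraction_subgroup_generated_by_emb[OF upper_central_normal(1)] by blast
  then show thesis using upper_central_imp_engel that by blast
qed

section \<open>Convex subuniverses\<close>

lemma emb_power: "emb (a ^ n) = multiple n (emb a)"
  by (induction n) (simp_all add: emb_one emb_mult)

text \<open>
  The element \<open>- a\<close> of the group of fractions is positive, so its conjugates by \<open>b\<close> and by \<open>- b\<close> are
  below multiples of it; negating and clearing denominators gives inequalities in the monoid.
\<close>

lemma power_le_conjugate:
  fixes a b :: "'a::residuated_lattice"
  assumes nil: "nilpotent TYPE('a)" and cancel: "cancellative TYPE('a)" and a: "a \<le> 1"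
  shows "\<exists>n. b * a ^ n \<le> a * b" "\<exists>n. a ^ n * b \<le> b * a"
proof -
  note ok = nilpotent_has_fractions[OF nil cancel]
  obtain c where E: "engel c TYPE('a fraction)" using nilpotent_imp_engel[OF nil] .
  define x where "x = - emb a"
  have "emb a \<le> 0" using a emb_le_iff[OF ok, of a 1] by (simp add: emb_one)
  then have x: "0 \<le> x" using lattice_group_uminus_le_iff[of 0 "emb a"] by (simp add: x_def)
  have pow: "\<exists>n. multiple n (emb a) \<le> conj_by h (emb a)" for h
    using conj_by_dominated[OF E x, of h]
    by (simp add: dominated_def x_def multiple_uminus conj_by_uminus lattice_group_uminus_le_iff)
  obtain n where "multiple n (emb a) \<le> conj_by (emb b) (emb a)"
    using pow by blast
  then have "emb b + multiple n (emb a) \<le> emb b + conj_by (emb b) (emb a)"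
    by (rule add_left_isotone)
  then have "emb (b * a ^ n) \<le> emb (a * b)"
    by (simp only: conj_by_def group_norm emb_mult emb_power)
  then show "\<exists>n. b * a ^ n \<le> a * b" by (auto simp: emb_le_iff[OF ok])
  obtain n where "multiple n (emb a) \<le> conj_by (- emb b) (emb a)"
    using pow by blast
  then have "multiple n (emb a) + emb b \<le> conj_by (- emb b) (emb a) + emb b"
    by (rule add_right_isotone)
  then have "emb (a ^ n * b) \<le> emb (b * a)"
    by (simp only: conj_by_def group_norm emb_mult emb_power)
  then show "\<exists>n. a ^ n * b \<le> b * a" by (auto simp: emb_le_iff[OF ok])
qed

theorem theorem6p1:
  assumes "nilpotent TYPE('a::residuated_lattice)"
    and "cancellative TYPE('a)"
  shows "hamiltonian TYPE('a)"
  unfolding hamiltonian_def normal_subuniverse_def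
proof (intro allI impI conjI ballI)
  fix H :: "'a set" and a b :: 'a
  assume H: "convex_subuniverse H" and "a \<in> H"
  \<comment> \<open>Conjugation is monotone and its values are at most \<open>1\<close>, so \<open>a\<close> may be lowered to \<open>a \<sqinter> 1\<close>.\<close>
  define a' where "a' = inf a 1"
  have one: "1 \<in> H" and closed: "\<And>x y. x \<in> H \<Longrightarrow> y \<in> H \<Longrightarrow> inf x y \<in> H \<and> x * y \<in> H"
    using H by (auto simp: convex_subuniverse_def subuniverse_def)
  have pow: "a' ^ n \<in> H" for n
    by (induction n) (use one closed \<open>a \<in> H\<close> in \<open>auto simp: a'_def\<close>)
  have convex: "x \<in> H" if "a' ^ n \<le> x" "x \<le> 1" for x n
    using H pow[of n] one that unfolding convex_subuniverse_def order_convex_def by blast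
  have a': "a' \<le> a" "a' \<le> 1" by (simp_all add: a'_def)
  have pow_le: "a' ^ n \<le> 1" for n
  proof (induction n)
    case (Suc n)
    then show ?case using residuated_mult_right_mono[OF a'(2), of "a' ^ n"] by simp
  qed simp
  obtain n where "b * a' ^ n \<le> a' * b" using power_le_conjugate[OF assms a'(2)] by blast
  then have "b * a' ^ n \<le> a * b" using residuated_mult_right_mono[OF a'(1)] order_trans by blast
  then have "a' ^ n \<le> left_conj b a" by (simp add: left_conj_def lres_residual pow_le)
  then show "left_conj b a \<in> H" by (rule convex) (simp add: left_conj_def)
  obtain n where "a' ^ n * b \<le> b * a'" using power_le_conjugate[OF assms a'(2)] by blast
  then have "a' ^ n * b \<le> b * a" using residuated_mult_left_mono[OF a'(1)] order_trans by blast
  then have "a' ^ n \<le> right_conj b a" by (simp add: right_conj_def rres_residual pow_le)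
  then show "right_conj b a \<in> H" by (rule convex) (simp add: right_conj_def)
qed

end
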